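(* Let $A$ be a $\mathbb{Z}$-graded associative algebra over a field $\mathbb{K}$ of characteristic zero, equipped with a degree $+1$ linear operator $\Delta : A \to A$ with $\Delta^2 = 0$ (no compatibility between $\Delta$ and the multiplication is assumed). Denote by $\gamma_n : A^{\otimes n} \to A$ the multiplication of $n$ ordered elements (so $\gamma_1 = id$). Then the maps $$m_1 = \Delta, \qquad m_2 = \Delta(\gamma_2) - \gamma_2(\Delta \otimes id) - \gamma_2(id \otimes \Delta),$$ and, for $n \geq 3$, $$m_n = \Delta(\gamma_n) - \gamma_2(\Delta(\gamma_{n-1}) \otimes id) - \gamma_2(id \otimes \Delta(\gamma_{n-1})) + \gamma_3(id \otimes \Delta(\gamma_{n-2}) \otimes id),$$ form an $A_\infty$-structure on $A[1]$.
   Context: Here $\Delta(\gamma_n)$ denotes the composite $\Delta \circ \gamma_n$, and similarly for the other expressions, which are composites of maps. Koszul sign rule: for homogeneous maps $f,g$ and homogeneous elements $x,y$, $(f \otimes g)(x \otimes y) = (-1)^{|g||x|} f(x) \otimes g(y)$. Degrees are those of $A$. An $A_\infty$-structure on $A[1]$, for a $\mathbb{Z}$-graded vector space $A$ with degree $+1$ differential $\Delta$, is a collection $\{m_n\}_{n \geq 2}$ of degree $+1$ maps $m_n : A^{\otimes n} \to A$ such that, putting $m_1 = \Delta$, for every $n \geq 1$ $$\sum_{n = i+j+k,\ k \geq 1,\ i,j \geq 0} m_{i+1+j}(id^{\otimes i} \otimes m_k \otimes id^{\otimes j}) = 0.$$ *)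

theory Defs
  imports Complex_Main
begin

text \<open>
  A linear map \<open>f : A\<^sup>\<otimes>\<^sup>n \<rightarrow> B\<close> is represented by the corresponding multilinear map, acting on
  lists of length \<open>n\<close>: the list \<open>[a\<^sub>1, ..., a\<^sub>n]\<close> stands for the elementary tensor
  \<open>a\<^sub>1 \<otimes> ... \<otimes> a\<^sub>n\<close>. Values on lists of other lengths are irrelevant.
\<close>

locale graded_vector_space = vector_space scale
  for scale :: "'k::field \<Rightarrow> 'a::ab_group_add \<Rightarrow> 'a" (infixr "*s" 75) +
  fixes A :: "int \<Rightarrow> 'a set"
  assumes subspace_grade: "subspace (A p)"
    and direct_sum:
      "\<exists>!c. (\<forall>p. c p \<in> A p) \<and> finite {p. c p \<noteq> 0} \<and> x = (\<Sum>p | c p \<noteq> 0. c p)"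
begin

definition component :: "'a \<Rightarrow> int \<Rightarrow> 'a" where
  "component x =
    (THE c. (\<forall>p. c p \<in> A p) \<and> finite {p. c p \<noteq> 0} \<and> x = (\<Sum>p | c p \<noteq> 0. c p))"

text \<open>
  The linear extension of \<open>x \<mapsto> (-1)\<^bsup>d |x|\<^esup> x\<close>, \<open>x\<close> homogeneous: the sign picked up when
  a map of degree \<open>d\<close> moves past \<open>x\<close>.
\<close>
definition koszul_sign :: "int \<Rightarrow> 'a \<Rightarrow> 'a" where
  "koszul_sign d x = (\<Sum>p | component x p \<noteq> 0. ((- 1) powi (d * p)) *s component x p)"

lemma koszul_sign_homogeneous:
  assumes "x \<in> A p"
  shows "koszul_sign d x = ((- 1) powi (d * p)) *s x"
proof -
  let ?c = "\<lambda>q. if q = p then x else 0"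
  have fin: "finite {q. ?c q \<noteq> 0}"
    by (rule finite_subset[of _ "{p}"]) auto
  have set: "{q. ?c q \<noteq> 0} = (if x = 0 then {} else {p})"
    by auto
  have "(\<forall>q. ?c q \<in> A q) \<and> finite {q. ?c q \<noteq> 0} \<and> x = (\<Sum>q | ?c q \<noteq> 0. ?c q)"
    using assms fin subspace_0[OF subspace_grade] unfolding set by auto
  then have "component x = ?c"
    unfolding component_def by (rule the1_equality[OF direct_sum])
  then show ?thesis
    unfolding koszul_sign_def by (simp only: set) auto
qed

definition multilinear :: "nat \<Rightarrow> ('a list \<Rightarrow> 'a) \<Rightarrow> bool" where
  "multilinear n f \<longleftrightarrow>
    (\<forall>as i. length as = n \<and> i < n \<longrightarrow> Vector_Spaces.linear scale scale (\<lambda>x. f (as[i := x])))"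

definition has_degree :: "nat \<Rightarrow> int \<Rightarrow> ('a list \<Rightarrow> 'a) \<Rightarrow> bool" where
  "has_degree n d f \<longleftrightarrow>
    (\<forall>as ps. length as = n \<and> length ps = n \<and> (\<forall>i<n. as ! i \<in> A (ps ! i)) \<longrightarrow>
      f as \<in> A (sum_list ps + d))"

definition differential :: "('a \<Rightarrow> 'a) \<Rightarrow> bool" where
  "differential D \<longleftrightarrow>
    Vector_Spaces.linear scale scale D \<and> (\<forall>p. \<forall>x\<in>A p. D x \<in> A (p + 1)) \<and> (\<forall>x. D (D x) = 0)"

text \<open>
  \<open>id\<^sup>\<otimes>\<^sup>i \<otimes> f \<otimes> id\<^sup>\<otimes>\<^sup>j\<close> on elementary tensors with \<open>i + k + j\<close> factors, for \<open>f\<close> of arity \<open>k\<close>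
  and degree \<open>d\<close>. By the Koszul rule, \<open>f\<close> moves past the first \<open>i\<close> factors.
\<close>
definition id_tensor_id :: "nat \<Rightarrow> nat \<Rightarrow> int \<Rightarrow> ('a list \<Rightarrow> 'a) \<Rightarrow> 'a list \<Rightarrow> 'a list" where
  "id_tensor_id i k d f as =
    map (koszul_sign d) (take i as) @ [f (take k (drop i as))] @ drop (i + k) as"

text \<open>
  \<open>m n\<close> is the \<open>n\<close>-ary operation. All degrees are those of \<open>A\<close>, not of the shift \<open>A[1]\<close>.
\<close>
definition A_infinity_structure :: "('a \<Rightarrow> 'a) \<Rightarrow> (nat \<Rightarrow> 'a list \<Rightarrow> 'a) \<Rightarrow> bool" where
  "A_infinity_structure D m \<longleftrightarrow>
    differential D \<and>
    (\<forall>a. m 1 [a] = D a) \<and>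
    (\<forall>n\<ge>2. multilinear n (m n) \<and> has_degree n 1 (m n)) \<and>
    (\<forall>n\<ge>1. \<forall>as. length as = n \<longrightarrow>
      (\<Sum>(i, k, j) | n = i + j + k \<and> k \<ge> 1. m (i + 1 + j) (id_tensor_id i k 1 (m k) as)) = 0)"

end

locale graded_algebra = graded_vector_space scale A
  for scale :: "'k::field \<Rightarrow> 'a::ring \<Rightarrow> 'a" (infixr "*s" 75) and A :: "int \<Rightarrow> 'a set" +
  assumes scale_mult_left: "(c *s x) * y = c *s (x * y)"
    and scale_mult_right: "x * (c *s y) = c *s (x * y)"
    and mult_grade: "x \<in> A p \<Longrightarrow> y \<in> A q \<Longrightarrow> x * y \<in> A (p + q)"
begin

text \<open>
  \<open>gamma\<close> on lists of length \<open>n\<close> is \<open>\<gamma>\<^sub>n\<close>. The algebra need not have a unit; the value on the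
  empty list is a dummy.
\<close>
fun gamma :: "'a list \<Rightarrow> 'a" where
  "gamma [] = 0"
| "gamma [a] = a"
| "gamma (a # b # as) = a * gamma (b # as)"

definition brace :: "('a \<Rightarrow> 'a) \<Rightarrow> nat \<Rightarrow> 'a list \<Rightarrow> 'a" where
  "brace D n as =
    (if n = 1 then D (hd as)
     else if n = 2 then
       D (gamma as)
       - gamma (id_tensor_id 0 1 1 (\<lambda>xs. D (hd xs)) as)
       - gamma (id_tensor_id 1 1 1 (\<lambda>xs. D (hd xs)) as)
     else
       D (gamma as)
       - gamma (id_tensor_id 0 (n - 1) 1 (D \<circ> gamma) as)
       - gamma (id_tensor_id 1 (n - 1) 1 (D \<circ> gamma) as)
       + gamma (id_tensor_id 1 (n - 2) 1 (D \<circ> gamma) as))"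

end

end

theory Submission
  imports Defs
begin

text \<open>
  The brackets are the trivial \<open>A\<^sub>\<infinity>\<close>-structure \<open>(\<Delta>, 0, 0, ...)\<close>, twisted by an automorphism of
  the tensor coalgebra. The products \<open>\<gamma>\<^sub>n\<close> are the components of a coalgebra automorphism \<open>F\<close>,
  whose inverse has components \<open>(-1)\<^bsup>n-1\<^esup> \<gamma>\<^sub>n\<close> because the multiplication is associative. If
  \<open>\<Delta>\<close> is extended to a coderivation, \<open>F\<inverse> \<circ> \<Delta> \<circ> F\<close> is again a coderivation of square zero. Its
  component at \<open>as\<close>, with \<open>\<sigma>\<close> denoting the operator \<open>a \<mapsto> (-1)\<^bsup>|a|\<^esup> a\<close>, is the sum,
  over all \<open>u @ v @ w = as\<close> and all ways of cutting \<open>u\<close> and \<open>w\<close> into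
  blocks, of \<open>\<plusminus> \<sigma> u \<cdot> \<Delta>(\<gamma>(v)) \<cdot> w\<close>, the sign being \<open>(-1)\<close> to the number of these blocks. The signed
  number of ways to cut a list of length \<open>n\<close> into blocks is \<open>1, -1, 0, 0, ...\<close> for
  \<open>n = 0, 1, 2, 3, ...\<close>, so only \<open>u\<close> and \<open>w\<close> of length at most one survive, and these are the
  four terms of the formula for \<open>m\<^sub>n\<close>.

  The proof carries this out by sums over splittings of a list, without constructing the
  coalgebra. Let \<open>b\<close> be the family of brackets, and also the coderivation it defines. Lemma
  \<open>sum_bracket_eq_differential\<close> is the last component of \<open>F \<circ> b = \<Delta> \<circ> F\<close>: the sum of
  \<open>\<sigma> p \<cdot> b(y) \<cdot> q\<close> over \<open>p @ y @ q = r\<close> is \<open>\<Delta>(\<gamma>(r))\<close>. Applied twice it gives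
  \<open>F \<circ> b \<circ> b = \<Delta> \<circ> \<Delta> \<circ> F = 0\<close>. When the list produced by the first \<open>b\<close> is split for the second,
  the new entry may lie inside the second bracket, to its left or to its right. The last two
  cases cancel, since \<open>b\<close> is odd (\<open>bracket_map_sign\<close>), and the first case collects the
  \<open>A\<^sub>\<infinity>\<close>-relators \<open>R\<close>. Hence the sum of \<open>p \<cdot> R(r) \<cdot> q\<close> over all splittings of a list vanishes
  (\<open>sum_relator_eq_0\<close>). Its term with \<open>p\<close> and \<open>q\<close> empty is the relator of the whole list, so all
  relators vanish by induction on the length (\<open>relator_eq_0\<close>): this is the injectivity of \<open>F\<close>.
\<close>

section \<open>Sums over splittings of a list\<close>

definition splits2 :: "'b list \<Rightarrow> ('b list \<times> 'b list) set" where
  "splits2 as = {(x, y). x @ y = as}"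

definition splits3 :: "'b list \<Rightarrow> ('b list \<times> 'b list \<times> 'b list) set" where
  "splits3 as = {(x, y, z). x @ y @ z = as \<and> y \<noteq> []}"

lemma finite_splits2 [simp]: "finite (splits2 as)"
proof (rule finite_subset)
  show "splits2 as \<subseteq> (\<lambda>i. (take i as, drop i as)) ` {..length as}"
  proof
    fix t assume "t \<in> splits2 as"
    then show "t \<in> (\<lambda>i. (take i as, drop i as)) ` {..length as}"
      by (intro image_eqI[where x = "length (fst t)"]) (auto simp: splits2_def)
  qed
qed simp

lemma finite_splits3 [simp]: "finite (splits3 as)"
proof (rule finite_subset)
  show "splits3 as \<subseteq> (\<Union>(x, t)\<in>splits2 as. (\<lambda>(y, z). (x, y, z)) ` splits2 t)"
    by (auto simp: splits2_def splits3_def)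
qed auto

lemma sum_splits2_Nil [simp]: "(\<Sum>(x, y)\<in>splits2 []. F x y) = F [] []"
proof -
  have "splits2 [] = {([], [] :: 'b list)}" by (auto simp: splits2_def)
  then show ?thesis by simp
qed

lemma sum_splits3_Nil [simp]: "(\<Sum>(x, y, z)\<in>splits3 []. F x y z) = 0"
proof -
  have "splits3 [] = ({} :: ('b list \<times> 'b list \<times> 'b list) set)" by (auto simp: splits3_def)
  then show ?thesis by simp
qed

lemma sum_splits2_Cons:
  "(\<Sum>(x, y)\<in>splits2 (a # as). F x y) = F [] (a # as) + (\<Sum>(x, y)\<in>splits2 as. F (a # x) y)"
proof -
  have eq: "splits2 (a # as) = insert ([], a # as) ((\<lambda>(x, y). (a # x, y)) ` splits2 as)"
    by (auto simp: splits2_def image_iff append_eq_Cons_conv)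
  have "inj_on (\<lambda>(x, y). (a # x, y)) (splits2 as)" by (auto simp: inj_on_def)
  then show ?thesis unfolding eq
    by (subst sum.insert) (auto simp: sum.reindex case_prod_unfold)
qed

lemma sum_splits3_Cons:
  "(\<Sum>(x, y, z)\<in>splits3 (a # as). F x y z)
    = (\<Sum>(y, z)\<in>splits2 as. F [] (a # y) z) + (\<Sum>(x, y, z)\<in>splits3 as. F (a # x) y z)"
proof -
  let ?S = "(\<lambda>(y, z). ([], a # y, z)) ` splits2 as" and ?T = "(\<lambda>(x, y, z). (a # x, y, z)) ` splits3 as"
  have eq: "splits3 (a # as) = ?S \<union> ?T"
    by (auto simp: splits2_def splits3_def image_iff append_eq_Cons_conv)
  have "?S \<inter> ?T = {}" by auto
  moreover have "(\<Sum>(x, y, z)\<in>?S. F x y z) = (\<Sum>(y, z)\<in>splits2 as. F [] (a # y) z)"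
    by (subst sum.reindex) (auto simp: inj_on_def case_prod_unfold)
  moreover have "(\<Sum>(x, y, z)\<in>?T. F x y z) = (\<Sum>(x, y, z)\<in>splits3 as. F (a # x) y z)"
    by (subst sum.reindex) (auto simp: inj_on_def case_prod_unfold)
  ultimately show ?thesis unfolding eq by (simp add: sum.union_disjoint)
qed

lemma sum_splits2_rev:
  "(\<Sum>(x, y)\<in>splits2 as. F x y) = (\<Sum>(y, x)\<in>splits2 (rev as). F (rev x) (rev y))"
  by (rule sum.reindex_bij_witness[where i = "\<lambda>(y, x). (rev x, rev y)" and j = "\<lambda>(x, y). (rev y, rev x)"])
    (auto simp: splits2_def simp flip: rev_append)

lemma sum_splits2_map_involution:
  assumes "\<And>a. f (f a) = a"
  shows "(\<Sum>(x, y)\<in>splits2 (map f as). F x y) = (\<Sum>(x, y)\<in>splits2 as. F (map f x) (map f y))"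
  by (rule sum.reindex_bij_witness[where i = "map_prod (map f) (map f)" and j = "map_prod (map f) (map f)"])
    (auto simp: splits2_def assms o_def simp flip: map_append)

lemma sum_splits3_map_involution:
  assumes "\<And>a. f (f a) = a"
  shows "(\<Sum>(x, y, z)\<in>splits3 (map f as). F x y z)
    = (\<Sum>(x, y, z)\<in>splits3 as. F (map f x) (map f y) (map f z))"
  by (rule sum.reindex_bij_witness[where i = "\<lambda>(x, y, z). (map f x, map f y, map f z)"
        and j = "\<lambda>(x, y, z). (map f x, map f y, map f z)"])
    (auto simp: splits3_def assms o_def simp flip: map_append)

text \<open>
  Passes from the numerical indices \<open>(i, k, j)\<close> of the \<open>A\<^sub>\<infinity>\<close>-relations to the three pieces they
  cut out; concatenating pieces is easier to reindex than arithmetic on \<open>take\<close> and \<open>drop\<close>.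
\<close>
lemma sum_arities_eq_sum_splits3:
  "(\<Sum>(i, k, j) | length as = i + j + k \<and> 1 \<le> k. F (take i as) (take k (drop i as)) (drop (i + k) as))
    = (\<Sum>(x, y, z)\<in>splits3 as. F x y z)"
  by (rule sum.reindex_bij_witness[where i = "\<lambda>(x, y, z). (length x, length y, length z)"
        and j = "\<lambda>(i, k, j). (take i as, take k (drop i as), drop (i + k) as)"])
    (auto simp: splits3_def min_def Suc_le_eq append_take_drop_id simp flip: take_add append_assoc)

text \<open>
  Both sides run over the five-part splittings \<open>u @ p @ y @ q @ w\<close> with \<open>y\<close> nonempty; then
  \<open>p @ y @ q\<close> is nonempty as well, as the right-hand side requires.
\<close>
lemma sum_splits3_refine_outer:
  "(\<Sum>(x, y, z)\<in>splits3 as. \<Sum>(x1, x2)\<in>splits2 x. \<Sum>(z1, z2)\<in>splits2 z. F x1 x2 y z1 z2)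
    = (\<Sum>(u, r, w)\<in>splits3 as. \<Sum>(p, y, q)\<in>splits3 r. F u p y q w)"
  (is "?l = ?r")
proof -
  have "?l = (\<Sum>((x, y, z), (x1, x2), (z1, z2))
      \<in>Sigma (splits3 as) (\<lambda>(x, y, z). splits2 x \<times> splits2 z). F x1 x2 y z1 z2)"
    by (subst sum.Sigma[symmetric]) (auto simp: sum.cartesian_product case_prod_unfold)
  also have "\<dots> = (\<Sum>((u, r, w), (p, y, q))
      \<in>Sigma (splits3 as) (\<lambda>(u, r, w). splits3 r). F u p y q w)"
    by (rule sum.reindex_bij_witness[where
          j = "\<lambda>((x, y, z), (x1, x2), (z1, z2)). ((x1, x2 @ y @ z1, z2), (x2, y, z1))"
          and i = "\<lambda>((u, r, w), (p, y, q)). ((u @ p, y, q @ w), (u, p), (q, w))"])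
      (auto simp: splits2_def splits3_def)
  also have "\<dots> = ?r"
    by (subst sum.Sigma[symmetric]) (auto simp: case_prod_unfold)
  finally show ?thesis .
qed

text \<open>
  Two disjoint nonempty segments can be chosen left one first or right one first. The cross
  terms of \<open>b \<circ> b\<close> cancel in pairs along this bijection.
\<close>
lemma sum_splits3_exchange:
  "(\<Sum>(x, y, z)\<in>splits3 as. \<Sum>(z1, v, z2)\<in>splits3 z. F x y z1 v z2)
    = (\<Sum>(x, v, z)\<in>splits3 as. \<Sum>(x1, y, x2)\<in>splits3 x. F x1 y x2 v z)"
  (is "?l = ?r")
proof -
  have "?l = (\<Sum>((x, y, z), (z1, v, z2))
      \<in>Sigma (splits3 as) (\<lambda>(x, y, z). splits3 z). F x y z1 v z2)"
    by (subst sum.Sigma[symmetric]) (auto simp: case_prod_unfold)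
  also have "\<dots> = (\<Sum>((x, v, z), (x1, y, x2))
      \<in>Sigma (splits3 as) (\<lambda>(x, v, z). splits3 x). F x1 y x2 v z)"
    by (rule sum.reindex_bij_witness[where
          j = "\<lambda>((x, y, z), (z1, v, z2)). ((x @ y @ z1, v, z2), (x, y, z1))"
          and i = "\<lambda>((x, v, z), (x1, y, x2)). ((x1, y, x2 @ v @ z), (x2, v, z))"])
      (auto simp: splits3_def)
  also have "\<dots> = ?r"
    by (subst sum.Sigma[symmetric]) (auto simp: case_prod_unfold)
  finally show ?thesis .
qed

lemma sum_splits2_marked:
  "(\<Sum>(x, y)\<in>splits2 (p @ a # q). F x y)
    = (\<Sum>(q', y)\<in>splits2 q. F (p @ a # q') y) + (\<Sum>(x, p')\<in>splits2 p. F x (p' @ a # q))"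
  by (induction p arbitrary: F) (simp_all add: sum_splits2_Cons add_ac)

text \<open>
  The three sums collect the splittings whose middle part contains the marked entry \<open>a\<close>, lies to
  the right of it, and lies to the left of it.
\<close>
lemma sum_splits3_marked:
  "(\<Sum>(u, v, w)\<in>splits3 (p @ a # q). F u v w)
    = (\<Sum>(u, p')\<in>splits2 p. \<Sum>(q', w)\<in>splits2 q. F u (p' @ a # q') w)
    + (\<Sum>(q', v, w)\<in>splits3 q. F (p @ a # q') v w)
    + (\<Sum>(u, v, p')\<in>splits3 p. F u v (p' @ a # q))"
  by (induction p arbitrary: F)
    (simp_all add: sum_splits2_Cons sum_splits3_Cons sum_splits2_marked add_ac)


section \<open>The Koszul sign operator\<close>

context graded_vector_space
begin

lemma component_eqI:
  assumes "\<And>p. c p \<in> A p" "finite {p. c p \<noteq> 0}" "x = (\<Sum>p | c p \<noteq> 0. c p)"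
  shows "component x = c"
  unfolding component_def by (rule the1_equality[OF direct_sum]) (use assms in auto)

lemma component:
  shows component_in: "component x p \<in> A p"
    and finite_component: "finite {p. component x p \<noteq> 0}"
    and sum_component: "(\<Sum>p | component x p \<noteq> 0. component x p) = x"
proof -
  have "(\<forall>p. component x p \<in> A p) \<and> finite {p. component x p \<noteq> 0}
      \<and> x = (\<Sum>p | component x p \<noteq> 0. component x p)"
    unfolding component_def by (rule theI'[OF direct_sum])
  then show "component x p \<in> A p" "finite {p. component x p \<noteq> 0}"
    "(\<Sum>p | component x p \<noteq> 0. component x p) = x" by auto
qed

lemma component_add: "component (x + y) = (\<lambda>p. component x p + component y p)"
proof (rule component_eqI)
  let ?S = "{p. component x p \<noteq> 0} \<union> {p. component y p \<noteq> 0}"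
  have fin: "finite ?S" by (simp add: finite_component)
  show "component x p + component y p \<in> A p" for p
    by (intro subspace_add[OF subspace_grade] component_in)
  show "finite {p. component x p + component y p \<noteq> 0}"
    by (rule finite_subset[OF _ fin]) auto
  have "(\<Sum>p | component x p + component y p \<noteq> 0. component x p + component y p)
      = (\<Sum>p\<in>?S. component x p + component y p)"
    by (rule sum.mono_neutral_left[OF fin]) auto
  also have "\<dots> = (\<Sum>p\<in>?S. component x p) + (\<Sum>p\<in>?S. component y p)"
    by (rule sum.distrib)
  also have "(\<Sum>p\<in>?S. component x p) = x"
    by (subst (2) sum_component[symmetric], rule sum.mono_neutral_right[OF fin]) auto
  also have "(\<Sum>p\<in>?S. component y p) = y"
    by (subst (2) sum_component[symmetric], rule sum.mono_neutral_right[OF fin]) auto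
  finally show "x + y = (\<Sum>p | component x p + component y p \<noteq> 0. component x p + component y p)"
    by simp
qed

lemma koszul_sign_add: "koszul_sign d (x + y) = koszul_sign d x + koszul_sign d y"
proof -
  let ?S = "{p. component x p \<noteq> 0} \<union> {p. component y p \<noteq> 0}"
  let ?e = "\<lambda>p. (- 1) powi (d * p) :: 'k"
  have fin: "finite ?S" by (simp add: finite_component)
  have "koszul_sign d (x + y) = (\<Sum>p\<in>?S. ?e p *s (component x p + component y p))"
    unfolding koszul_sign_def component_add by (rule sum.mono_neutral_left[OF fin]) auto
  also have "\<dots> = (\<Sum>p\<in>?S. ?e p *s component x p) + (\<Sum>p\<in>?S. ?e p *s component y p)"
    by (simp add: scale_right_distrib sum.distrib)
  also have "(\<Sum>p\<in>?S. ?e p *s component x p) = koszul_sign d x"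
    unfolding koszul_sign_def by (rule sum.mono_neutral_right[OF fin]) auto
  also have "(\<Sum>p\<in>?S. ?e p *s component y p) = koszul_sign d y"
    unfolding koszul_sign_def by (rule sum.mono_neutral_right[OF fin]) auto
  finally show ?thesis .
qed

text \<open>
  Every element is a finite sum of its components, and the empty sum is homogeneous of any degree.
\<close>
lemma homogeneous_induct [case_names homogeneous add]:
  assumes hom: "\<And>p x. x \<in> A p \<Longrightarrow> P x" and add: "\<And>x y. P x \<Longrightarrow> P y \<Longrightarrow> P (x + y)"
  shows "P x"
proof -
  have "P 0" using hom subspace_0[OF subspace_grade] by blast
  then have "P (\<Sum>p\<in>S. component x p)" for S
    by (induction S rule: infinite_finite_induct) (auto intro: add hom component_in)
  then show ?thesis using sum_component[of x] by metis
qed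

lemma koszul_sign_scale: "koszul_sign d (c *s x) = c *s koszul_sign d x"
proof (induction x rule: homogeneous_induct)
  case (homogeneous p x)
  then show ?case
    using koszul_sign_homogeneous[of "c *s x" p d] koszul_sign_homogeneous[of x p d]
      subspace_scale[OF subspace_grade]
    by (simp add: scale_left_commute)
qed (simp add: scale_right_distrib koszul_sign_add)

lemma linear_koszul_sign: "Vector_Spaces.linear scale scale (koszul_sign d)"
  by (simp add: Vector_Spaces.linear_iff koszul_sign_add koszul_sign_scale vector_space_axioms)

lemma koszul_sign_in_grade: "x \<in> A p \<Longrightarrow> koszul_sign d x \<in> A p"
  by (simp add: koszul_sign_homogeneous subspace_scale[OF subspace_grade])

lemma koszul_sign_involution [simp]: "koszul_sign d (koszul_sign d x) = x"
proof (induction x rule: homogeneous_induct)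
  case (homogeneous p x)
  then have "koszul_sign d (koszul_sign d x) = ((- 1) powi (d * p) * (- 1) powi (d * p)) *s x"
    by (simp add: koszul_sign_homogeneous koszul_sign_scale)
  also have "(- 1) powi (d * p) * (- 1) powi (d * p) = (1 :: 'k)"
    by (simp flip: power_int_mult_distrib)
  finally show ?case by simp
qed (simp add: koszul_sign_add)

lemma koszul_sign_differential:
  assumes "differential D"
  shows "koszul_sign 1 (D x) = - D (koszul_sign 1 x)"
proof (induction x rule: homogeneous_induct)
  case (homogeneous p x)
  interpret D: Vector_Spaces.linear scale scale D using assms by (simp add: differential_def)
  have "D x \<in> A (p + 1)" using assms homogeneous by (simp add: differential_def)
  with homogeneous show ?case
    by (simp add: koszul_sign_homogeneous D.scale power_int_add)
next
  case (add x y)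
  interpret D: Vector_Spaces.linear scale scale D using assms by (simp add: differential_def)
  from add show ?case by (simp add: koszul_sign_add D.add)
qed

lemma linear_sum: "Vector_Spaces.linear scale scale f \<Longrightarrow> f (\<Sum>i\<in>I. g i) = (\<Sum>i\<in>I. f (g i))"
  using module_hom.sum[of scale scale f g I] by (simp add: module_hom_iff_linear)

lemma linear_neg: "Vector_Spaces.linear scale scale f \<Longrightarrow> f (- x) = - f x"
  using module_hom.neg[of scale scale f x] by (simp add: module_hom_iff_linear)

lemma linear_0: "Vector_Spaces.linear scale scale f \<Longrightarrow> f 0 = 0"
  using module_hom.zero[of scale scale f] by (simp add: module_hom_iff_linear)

lemma linear_add: "Vector_Spaces.linear scale scale f \<Longrightarrow> Vector_Spaces.linear scale scale g
    \<Longrightarrow> Vector_Spaces.linear scale scale (\<lambda>x. f x + g x)"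
  by (simp add: Vector_Spaces.linear_iff scale_right_distrib)

lemma linear_scale: "Vector_Spaces.linear scale scale f
    \<Longrightarrow> Vector_Spaces.linear scale scale (\<lambda>x. c *s f x)"
  by (simp add: Vector_Spaces.linear_iff scale_right_distrib scale_left_commute)

lemma linear_zero: "Vector_Spaces.linear scale scale (\<lambda>x. 0)"
  by (simp add: Vector_Spaces.linear_iff vector_space_axioms)

lemma linear_sum_fun:
  assumes "\<And>i. i \<in> I \<Longrightarrow> Vector_Spaces.linear scale scale (f i)"
  shows "Vector_Spaces.linear scale scale (\<lambda>x. \<Sum>i\<in>I. f i x)"
  using assms by (induction I rule: infinite_finite_induct) (auto intro: linear_add linear_zero)

lemma linear_comp:
  assumes "Vector_Spaces.linear scale scale f" "Vector_Spaces.linear scale scale g"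
  shows "Vector_Spaces.linear scale scale (\<lambda>x. f (g x))"
  using assms by (simp add: Vector_Spaces.linear_iff)

lemma multilinearI:
  assumes "\<And>p a q. length p + length q + 1 = n \<Longrightarrow> Vector_Spaces.linear scale scale (\<lambda>x. f (p @ x # q))"
  shows "multilinear n f"
  unfolding multilinear_def
proof (intro allI impI)
  fix as :: "'a list" and i assume "length as = n \<and> i < n"
  then show "Vector_Spaces.linear scale scale (\<lambda>x. f (as[i := x]))"
    using assms[of "take i as" "drop (Suc i) as"] by (simp add: upd_conv_take_nth_drop)
qed

lemma multilinearD:
  assumes "multilinear n f" "length p + length q + 1 = n"
  shows "Vector_Spaces.linear scale scale (\<lambda>x. f (p @ x # q))"
  using assms(1)[unfolded multilinear_def, rule_format, of "p @ 0 # q" "length p"] assms(2) by simp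

lemma multilinear_cong:
  assumes "\<And>as. length as = n \<Longrightarrow> f as = g as"
  shows "multilinear n f \<longleftrightarrow> multilinear n g"
  unfolding multilinear_def by (simp add: assms cong: conj_cong)

text \<open>
  The slot that varies lies before, inside or after the block on which \<open>g\<close> acts. In the first
  case it also passes through the Koszul sign operator, which is why linearity of that operator
  is needed.
\<close>
lemma multilinear_id_tensor_id:
  assumes f: "multilinear (i + 1 + j) f" and g: "multilinear k g"
  shows "multilinear (i + k + j) (\<lambda>as. f (id_tensor_id i k d g as))"
proof (rule multilinearI)
  fix p q :: "'a list" assume len: "length p + length q + 1 = i + k + j"
  let ?s = "koszul_sign d"
  consider (left) "length p < i" | (mid) "i \<le> length p" "length p < i + k" | (right) "i + k \<le> length p"
    by linarith
  then show "Vector_Spaces.linear scale scale (\<lambda>x. f (id_tensor_id i k d g (p @ x # q)))"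
  proof cases
    case left
    then obtain l where i: "i = length p + 1 + l"
      by (metis Suc_eq_plus1 add_Suc_right less_iff_Suc_add add.commute)
    have "id_tensor_id i k d g (p @ x # q)
        = map ?s p @ ?s x # (map ?s (take l q) @ [g (take k (drop l q))] @ drop (l + k) q)" for x
      by (simp add: id_tensor_id_def i)
    moreover have "Vector_Spaces.linear scale scale (\<lambda>x. f (map ?s p @ ?s x #
        (map ?s (take l q) @ [g (take k (drop l q))] @ drop (l + k) q)))"
      by (rule linear_comp[OF multilinearD[OF f] linear_koszul_sign]) (use len i in auto)
    ultimately show ?thesis by simp
  next
    case mid
    then obtain l where p: "length p = i + l" and l: "l < k" by (metis le_iff_add add_less_cancel_left)
    have "id_tensor_id i k d g (p @ x # q)
        = map ?s (take i p) @ g (drop i p @ x # take (k - l - 1) q) # drop (k - l - 1) q" for x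
    proof -
      have "k - l = Suc (k - l - 1)" using l by simp
      then have "take (k - l) (x # q) = x # take (k - l - 1) q" "drop (k - l) (x # q) = drop (k - l - 1) q"
        by (metis take_Suc_Cons, metis drop_Suc_Cons)
      with p l show ?thesis by (simp add: id_tensor_id_def)
    qed
    moreover have "Vector_Spaces.linear scale scale (\<lambda>x.
        f (map ?s (take i p) @ g (drop i p @ x # take (k - l - 1) q) # drop (k - l - 1) q))"
      by (rule linear_comp[OF multilinearD[OF f] multilinearD[OF g]]) (use len p l in auto)
    ultimately show ?thesis by simp
  next
    case right
    have "id_tensor_id i k d g (p @ x # q)
        = (map ?s (take i p) @ g (take k (drop i p)) # drop (i + k) p) @ x # q" for x
      using right by (simp add: id_tensor_id_def)
    moreover have "Vector_Spaces.linear scale scale (\<lambda>x.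
        f ((map ?s (take i p) @ g (take k (drop i p)) # drop (i + k) p) @ x # q))"
      by (rule multilinearD[OF f]) (use len right in auto)
    ultimately show ?thesis by simp
  qed
qed

lemma has_degree_iff:
  "has_degree n d f \<longleftrightarrow> (\<forall>as ps. length as = n \<and> list_all2 (\<lambda>a p. a \<in> A p) as ps \<longrightarrow> f as \<in> A (sum_list ps + d))"
  unfolding has_degree_def list_all2_conv_all_nth by auto

text \<open>
  The Koszul signs preserve the degrees of the factors, whatever degree \<open>d'\<close> they are taken for.
\<close>
lemma has_degree_id_tensor_id:
  assumes f: "has_degree (i + 1 + j) e f" and g: "has_degree k d g"
  shows "has_degree (i + k + j) (e + d) (\<lambda>as. f (id_tensor_id i k d' g as))"
  unfolding has_degree_iff
proof (intro allI impI, elim conjE)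
  fix as ps assume len: "length as = i + k + j" and hom: "list_all2 (\<lambda>a p. a \<in> A p) as ps"
  let ?qs = "take i ps @ [sum_list (take k (drop i ps)) + d] @ drop (i + k) ps"
  have "list_all2 (\<lambda>a p. a \<in> A p) (map (koszul_sign d') (take i as)) (take i ps)"
    using list_all2_takeI[OF hom, of i] unfolding list_all2_map1
    by (rule list_all2_mono) (rule koszul_sign_in_grade)
  moreover have "g (take k (drop i as)) \<in> A (sum_list (take k (drop i ps)) + d)"
    using g[unfolded has_degree_iff, rule_format, of "take k (drop i as)"] len hom
    by (simp add: list_all2_takeI list_all2_dropI)
  ultimately have "list_all2 (\<lambda>a p. a \<in> A p) (id_tensor_id i k d' g as) ?qs"
    using hom by (simp add: id_tensor_id_def list_all2_appendI list_all2_dropI)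
  moreover have "length (id_tensor_id i k d' g as) = i + 1 + j"
    using len by (simp add: id_tensor_id_def)
  ultimately have "f (id_tensor_id i k d' g as) \<in> A (sum_list ?qs + e)"
    using f unfolding has_degree_iff by blast
  moreover have "sum_list ps = sum_list (take i ps @ take k (drop i ps) @ drop (i + k) ps)"
    by (metis append_take_drop_id drop_drop add.commute)
  ultimately show "f (id_tensor_id i k d' g as) \<in> A (sum_list ps + (e + d))"
    by (simp add: add_ac)
qed

end


section \<open>Products of lists\<close>

context graded_algebra
begin

lemma gamma_Cons: "as \<noteq> [] \<Longrightarrow> gamma (a # as) = a * gamma as"
  by (cases as) auto

lemma gamma_append: "as \<noteq> [] \<Longrightarrow> bs \<noteq> [] \<Longrightarrow> gamma (as @ bs) = gamma as * gamma bs"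
  by (induction as rule: gamma.induct) (auto simp: gamma_Cons mult.assoc)

text \<open>
  Associativity: a block that was multiplied beforehand may be spliced in. Only nonempty
  blocks, as there is no unit to serve as the empty product.
\<close>
lemma gamma_flatten:
  assumes "bs \<noteq> []"
  shows "gamma (as @ gamma bs # cs) = gamma (as @ bs @ cs)"
proof -
  have "gamma (gamma bs # cs) = gamma (bs @ cs)"
    using assms by (cases "cs = []") (auto simp: gamma_Cons gamma_append)
  then show ?thesis
    using assms by (cases "as = []") (auto simp: gamma_append)
qed

lemma linear_mult_left: "Vector_Spaces.linear scale scale (\<lambda>x. a * x)"
  by (simp add: Vector_Spaces.linear_iff distrib_left scale_mult_right vector_space_axioms)

lemma linear_mult_right: "Vector_Spaces.linear scale scale (\<lambda>x. x * a)"
  by (simp add: Vector_Spaces.linear_iff distrib_right scale_mult_left vector_space_axioms)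

lemma linear_gamma: "Vector_Spaces.linear scale scale (\<lambda>x. gamma (p @ x # q))"
proof (induction p)
  case Nil
  then show ?case
    by (cases q) (auto simp: linear_mult_right linear_id[unfolded id_def])
next
  case (Cons a p)
  then show ?case
    using linear_comp[OF linear_mult_left] by (simp add: gamma_Cons)
qed

lemma multilinear_gamma: "multilinear n gamma"
  by (rule multilinearI) (rule linear_gamma)

lemma has_degree_gamma:
  assumes "1 \<le> n"
  shows "has_degree n 0 gamma"
proof -
  have "list_all2 (\<lambda>a p. a \<in> A p) as ps \<Longrightarrow> as \<noteq> [] \<Longrightarrow> gamma as \<in> A (sum_list ps)" for as ps
  proof (induction as ps rule: list_all2_induct)
    case (Cons a as p ps)
    then show ?case by (cases "as = []") (auto simp: gamma_Cons mult_grade)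
  qed simp
  moreover have "as \<noteq> []" if "length as = n" for as :: "'a list" using assms that by auto
  ultimately show ?thesis by (simp add: has_degree_iff)
qed

lemma koszul_sign_mult: "koszul_sign d (x * y) = koszul_sign d x * koszul_sign d y"
proof (induction x rule: homogeneous_induct)
  case (homogeneous p x)
  show ?case
  proof (induction y rule: homogeneous_induct)
    case (homogeneous q y)
    with \<open>x \<in> A p\<close> mult_grade[of x p y q] show ?case
      by (simp add: koszul_sign_homogeneous scale_mult_left scale_mult_right distrib_left power_int_add)
  qed (simp add: distrib_left koszul_sign_add)
qed (simp add: distrib_right koszul_sign_add)

lemma gamma_map_koszul_sign: "gamma (map (koszul_sign d) as) = koszul_sign d (gamma as)"
proof (induction as rule: gamma.induct)
  case 1
  show ?case using koszul_sign_scale[of d 0 0] by simp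
qed (simp_all add: koszul_sign_mult)


section \<open>The brackets as a twist of the differential\<close>

text \<open>
  The signed count of the ways to cut a list of length \<open>n\<close> into nonempty blocks, with sign
  \<open>(-1)\<close> to the number of blocks.
\<close>
definition weight :: "nat \<Rightarrow> 'k" where
  "weight n = (if n = 0 then 1 else if n = 1 then - 1 else 0)"

text \<open>
  Under convolution over splittings, \<open>weight\<close> is inverse to the function that is constantly one:
  for power series, \<open>(1 - t) \<cdot> (1 + t + t\<^sup>2 + ...) = 1\<close>.
\<close>
lemma sum_weight_prefix: "(\<Sum>(u, v)\<in>splits2 as. weight (length u)) = (if as = [] then 1 else 0)"
proof (cases as)
  case (Cons a bs)
  have "(\<Sum>(u, v)\<in>splits2 bs. weight (length (a # u))) = - 1"
    by (cases bs) (simp_all add: sum_splits2_Cons weight_def)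
  with Cons show ?thesis by (simp add: sum_splits2_Cons weight_def)
qed (simp add: weight_def)

lemma sum_weight_suffix: "(\<Sum>(u, v)\<in>splits2 as. weight (length v)) = (if as = [] then 1 else 0)"
  by (subst sum_splits2_rev) (simp add: sum_weight_prefix)

context
  fixes D :: "'a \<Rightarrow> 'a"
  assumes D: "differential D"
begin

lemma linear_D: "Vector_Spaces.linear scale scale D"
  using D by (simp add: differential_def)

abbreviation \<sigma> :: "'a \<Rightarrow> 'a" where "\<sigma> \<equiv> koszul_sign 1"

definition bracket :: "'a list \<Rightarrow> 'a" where
  "bracket as = brace D (length as) as"

text \<open>
  Weights leave at most one factor on either side of the inner block, so at most four indices
  contribute. A list of length two leaves no inner block for the index with a factor on both
  sides, and a list of length one leaves it only for the index without outer factors; this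
  accounts for the separate cases in the definition of \<open>brace\<close>.
\<close>
lemma brace_eq_sum:
  assumes "1 \<le> length as"
  shows "brace D (length as) as = (\<Sum>(i, k, j) | length as = i + j + k \<and> 1 \<le> k.
    (weight i * weight j) *s gamma (id_tensor_id i k 1 (D \<circ> gamma) as))"
proof -
  let ?n = "length as"
  let ?I = "{(i, k, j). ?n = i + j + k \<and> 1 \<le> k}"
  \<comment> \<open>Intersecting with \<open>?I\<close> discards the indices falsified by truncated subtraction.\<close>
  let ?J = "{(0, ?n, 0), (1, ?n - 1, 0), (0, ?n - 1, 1), (1, ?n - 2, 1)} \<inter> ?I"
  let ?t = "\<lambda>(i, k, j). (weight i * weight j) *s gamma (id_tensor_id i k 1 (D \<circ> gamma) as)"
  have fin: "finite ?I"
    by (rule finite_subset[of _ "{..?n} \<times> {..?n} \<times> {..?n}"]) auto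
  have "sum ?t ?I = sum ?t ?J"
    by (rule sum.mono_neutral_right[OF fin]) (auto simp: weight_def split: if_splits)
  also have "\<dots> = brace D ?n as"
  proof -
    consider a where "as = [a]" | a b where "as = [a, b]" | "3 \<le> ?n"
      using assms by (cases as rule: gamma.cases) (auto simp: neq_Nil_conv Suc_le_eq, metis list.exhaust)
    then show ?thesis
    proof cases
      case 1
      then have "?J = {(0, 1, 0)}" by auto
      with 1 show ?thesis by (simp add: brace_def weight_def id_tensor_id_def)
    next
      case 2
      then have "?J = {(0, 2, 0), (1, 1, 0), (0, 1, 1)}" by auto
      with 2 show ?thesis by (simp add: brace_def weight_def id_tensor_id_def)
    next
      case 3
      then have "?J = {(0, ?n, 0), (1, ?n - 1, 0), (0, ?n - 1, 1), (1, ?n - 2, 1)}" by auto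
      moreover from 3 have "as \<noteq> []" by auto
      moreover have "?n \<noteq> 1" "?n \<noteq> 2" using 3 by auto
      ultimately show ?thesis using 3
        by (simp add: brace_def weight_def) (simp add: id_tensor_id_def)
    qed
  qed
  finally show ?thesis by simp
qed

lemma bracket_eq_sum_splits3:
  assumes "as \<noteq> []"
  shows "bracket as = (\<Sum>(u, v, w)\<in>splits3 as.
    (weight (length u) * weight (length w)) *s gamma (map \<sigma> u @ D (gamma v) # w))"
proof -
  have "bracket as = (\<Sum>(i, k, j) | length as = i + j + k \<and> 1 \<le> k.
      (weight (length (take i as)) * weight (length (drop (i + k) as)))
        *s gamma (map \<sigma> (take i as) @ D (gamma (take k (drop i as))) # drop (i + k) as))"
    unfolding bracket_def using assms
    by (subst brace_eq_sum) (auto simp: Suc_le_eq id_tensor_id_def intro!: sum.cong)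
  also have "\<dots> = (\<Sum>(u, v, w)\<in>splits3 as.
      (weight (length u) * weight (length w)) *s gamma (map \<sigma> u @ D (gamma v) # w))"
    by (rule sum_arities_eq_sum_splits3[where F =
          "\<lambda>u v w. (weight (length u) * weight (length w)) *s gamma (map \<sigma> u @ D (gamma v) # w)"])
  finally show ?thesis .
qed

text \<open>
  The bracket has degree one, so \<open>\<sigma>\<close> anticommutes with it. In each term \<open>\<sigma>\<close> is multiplicative and
  passes the single \<open>D\<close> with a minus sign.
\<close>
lemma bracket_map_sign:
  assumes "as \<noteq> []"
  shows "bracket (map \<sigma> as) = - \<sigma> (bracket as)"
proof -
  have "gamma (map \<sigma> (map \<sigma> u) @ D (gamma (map \<sigma> v)) # map \<sigma> w)
      = - \<sigma> (gamma (map \<sigma> u @ D (gamma v) # w))" for u v w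
  proof -
    have "D (gamma (map \<sigma> v)) = \<sigma> (- D (gamma v))"
      by (simp add: gamma_map_koszul_sign linear_neg[OF linear_koszul_sign] koszul_sign_differential[OF D])
    then have "gamma (map \<sigma> (map \<sigma> u) @ D (gamma (map \<sigma> v)) # map \<sigma> w)
        = \<sigma> (gamma (map \<sigma> u @ (- D (gamma v)) # w))"
      by (simp flip: gamma_map_koszul_sign)
    also have "\<dots> = - \<sigma> (gamma (map \<sigma> u @ D (gamma v) # w))"
      by (simp only: linear_neg[OF linear_gamma] linear_neg[OF linear_koszul_sign])
    finally show ?thesis .
  qed
  note sign = this
  have "bracket (map \<sigma> as) = (\<Sum>(u, v, w)\<in>splits3 as. (weight (length u) * weight (length w))
      *s gamma (map \<sigma> (map \<sigma> u) @ D (gamma (map \<sigma> v)) # map \<sigma> w))"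
    using assms by (simp add: bracket_eq_sum_splits3 sum_splits3_map_involution)
  also have "\<dots> = - \<sigma> (bracket as)"
    unfolding sign using assms
    by (simp add: bracket_eq_sum_splits3 linear_sum[OF linear_koszul_sign] koszul_sign_scale
        sum_negf case_prod_unfold)
  finally show ?thesis .
qed

text \<open>
  The intertwining relation \<open>F \<circ> b = \<Delta> \<circ> F\<close> in its last component. After expanding \<open>b\<close>, each
  product \<open>P \<cdot> D(v) \<cdot> Q\<close> occurs once for every cut of \<open>P\<close> and of \<open>Q\<close> into a part outside and a
  part inside the bracket. The weights of these cuts add up to zero unless \<open>P\<close> and \<open>Q\<close> are
  empty.
\<close>
lemma sum_bracket_eq_differential:
  assumes "r \<noteq> []"
  shows "(\<Sum>(p, y, q)\<in>splits3 r. gamma (map \<sigma> p @ bracket y # q)) = D (gamma r)"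
proof -
  let ?t = "\<lambda>P v Q. gamma (map \<sigma> P @ D (gamma v) # Q)"
  have "(\<Sum>(p, y, q)\<in>splits3 r. gamma (map \<sigma> p @ bracket y # q))
      = (\<Sum>(p, y, q)\<in>splits3 r. \<Sum>(u, v, w)\<in>splits3 y.
          (weight (length u) * weight (length w)) *s ?t (p @ u) v (w @ q))"
  proof (rule sum.cong[OF refl], clarify)
    fix p y q assume "(p, y, q) \<in> splits3 r"
    then have "y \<noteq> []" by (simp add: splits3_def)
    then show "gamma (map \<sigma> p @ bracket y # q) = (\<Sum>(u, v, w)\<in>splits3 y.
          (weight (length u) * weight (length w)) *s ?t (p @ u) v (w @ q))"
      using linear_gamma[unfolded Vector_Spaces.linear_iff, of "map \<sigma> p" q]
      by (simp add: bracket_eq_sum_splits3 linear_sum[OF linear_gamma] case_prod_unfold gamma_flatten)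
  qed
  also have "\<dots> = (\<Sum>(P, v, Q)\<in>splits3 r. \<Sum>(p, u)\<in>splits2 P. \<Sum>(w, q)\<in>splits2 Q.
          (weight (length u) * weight (length w)) *s ?t (p @ u) v (w @ q))"
    by (rule sum_splits3_refine_outer[symmetric])
  also have "\<dots> = (\<Sum>(P, v, Q)\<in>splits3 r. \<Sum>(p, u)\<in>splits2 P. \<Sum>(w, q)\<in>splits2 Q.
          (weight (length u) * weight (length w)) *s ?t P v Q)"
    by (intro sum.cong refl) (auto simp: splits2_def intro!: sum.cong)
  also have "\<dots> = (\<Sum>(P, v, Q)\<in>splits3 r. ((\<Sum>(p, u)\<in>splits2 P. weight (length u))
      * (\<Sum>(w, q)\<in>splits2 Q. weight (length w))) *s ?t P v Q)"
    by (simp add: sum_product scale_sum_left case_prod_unfold)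
  also have "\<dots> = (\<Sum>(P, v, Q)\<in>{([], r, [])}. ?t P v Q)"
    unfolding sum_weight_prefix sum_weight_suffix
    by (rule sum.mono_neutral_cong_right)
      (use assms finite_splits3[of r] in \<open>auto simp: splits3_def split: if_splits\<close>)
  finally show ?thesis by simp
qed

definition relator :: "'a list \<Rightarrow> 'a" where
  "relator as = (\<Sum>(x, y, z)\<in>splits3 as. bracket (map \<sigma> x @ bracket y # z))"

text \<open>
  This is \<open>F \<circ> b \<circ> b = \<Delta> \<circ> \<Delta> \<circ> F = 0\<close>. In the terms with two disjoint brackets the right one may
  be formed second or first. Then \<open>\<sigma>\<close> is applied to the left bracket or to its arguments,
  respectively, and \<open>bracket_map_sign\<close> shows that the two orders have opposite signs.
\<close>
lemma sum_relator_eq_0: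
  assumes "as \<noteq> []"
  shows "(\<Sum>(p, r, q)\<in>splits3 as. gamma (p @ relator r # q)) = 0"
proof -
  have s: "\<And>a. \<sigma> (\<sigma> a) = a" by simp
  \<comment> \<open>The second bracket contains the first, lies to its right, or lies to its left. Entries that
    both brackets have passed carry two signs, which cancel.\<close>
  let ?V = "\<Sum>(x, y, z)\<in>splits3 as. \<Sum>(x1, x2)\<in>splits2 x. \<Sum>(z1, z2)\<in>splits2 z.
      gamma (x1 @ bracket (map \<sigma> x2 @ bracket y # z1) # z2)"
  let ?L = "\<Sum>(x, y, z)\<in>splits3 as. \<Sum>(z1, v, z2)\<in>splits3 z.
      gamma (x @ \<sigma> (bracket y) # map \<sigma> z1 @ bracket v # z2)"
  let ?R = "\<Sum>(x, y, z)\<in>splits3 as. \<Sum>(x1, v, x2)\<in>splits3 x.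
      gamma (x1 @ bracket (map \<sigma> v) # map \<sigma> x2 @ bracket y # z)"
  have "0 = D (D (gamma as))" using D by (simp add: differential_def)
  also have "\<dots> = (\<Sum>(x, y, z)\<in>splits3 as. D (gamma (map \<sigma> x @ bracket y # z)))"
    by (simp add: linear_sum[OF linear_D] case_prod_unfold flip: sum_bracket_eq_differential[OF assms])
  also have "\<dots> = (\<Sum>(x, y, z)\<in>splits3 as.
      (\<Sum>(u, v, w)\<in>splits3 (map \<sigma> x @ bracket y # z). gamma (map \<sigma> u @ bracket v # w)))"
    by (simp add: sum_bracket_eq_differential)
  also have "\<dots> = ?V + ?L + ?R"
    by (simp add: sum_splits3_marked sum_splits2_map_involution[OF s] sum_splits3_map_involution[OF s] o_def)
      (simp add: sum.distrib case_prod_unfold)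
  also have "?R = - ?L"
  proof -
    have "?R = (\<Sum>(x, y, z)\<in>splits3 as. \<Sum>(x1, v, x2)\<in>splits3 x.
        - gamma (x1 @ \<sigma> (bracket v) # map \<sigma> x2 @ bracket y # z))"
    proof (intro sum.cong refl, clarify, intro sum.cong refl, clarify)
      fix x y z x1 v x2 assume "(x1, v, x2) \<in> splits3 (x :: 'a list)"
      then have "bracket (map \<sigma> v) = - \<sigma> (bracket v)"
        by (intro bracket_map_sign) (simp add: splits3_def)
      then show "gamma (x1 @ bracket (map \<sigma> v) # map \<sigma> x2 @ bracket y # z)
          = - gamma (x1 @ \<sigma> (bracket v) # map \<sigma> x2 @ bracket y # z)"
        by (simp only: linear_neg[OF linear_gamma])
    qed
    also have "\<dots> = - (\<Sum>(x, y, z)\<in>splits3 as. \<Sum>(x1, v, x2)\<in>splits3 x.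
        gamma (x1 @ \<sigma> (bracket v) # map \<sigma> x2 @ bracket y # z))"
      by (simp add: sum_negf case_prod_unfold)
    also have "\<dots> = - ?L" by (simp only: sum_splits3_exchange)
    finally show ?thesis .
  qed
  also have "?V = (\<Sum>(p, r, q)\<in>splits3 as. gamma (p @ relator r # q))"
    unfolding sum_splits3_refine_outer relator_def
    by (simp add: linear_sum[OF linear_gamma] case_prod_unfold)
  finally show ?thesis by simp
qed

text \<open>
  In \<open>sum_relator_eq_0\<close> all terms but the one for \<open>p = q = []\<close> involve relators of shorter lists.
\<close>
lemma relator_eq_0: "relator as = 0"
proof (induction as rule: length_induct)
  case (1 as)
  show ?case
  proof (cases "as = []")
    case True
    then show ?thesis by (simp add: relator_def)
  next
    case False
    have "0 = (\<Sum>(p, r, q)\<in>splits3 as. gamma (p @ relator r # q))"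
      using False by (simp add: sum_relator_eq_0)
    also have "\<dots> = (\<Sum>(p, r, q)\<in>{([], as, [])}. gamma (p @ relator r # q))"
    proof (rule sum.mono_neutral_right)
      have "gamma (p @ relator r # q) = 0"
        if "(p, r, q) \<in> splits3 as" "(p, r, q) \<noteq> ([], as, [])" for p r q
      proof -
        from that have "length r < length as" by (auto simp: splits3_def)
        with 1 show ?thesis by (simp add: linear_0[OF linear_gamma])
      qed
      then show "\<forall>t\<in>splits3 as - {([], as, [])}. (case t of (p, r, q) \<Rightarrow> gamma (p @ relator r # q)) = 0"
        by auto
      show "{([], as, [])} \<subseteq> splits3 as" using False by (simp add: splits3_def)
    qed simp
    finally show ?thesis by simp
  qed
qed

lemma multilinear_brace:
  assumes "1 \<le> n"
  shows "multilinear n (brace D n)"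
proof -
  have "multilinear n (\<lambda>as. \<Sum>(i, k, j) | n = i + j + k \<and> 1 \<le> k.
    (weight i * weight j) *s gamma (id_tensor_id i k 1 (D \<circ> gamma) as))"
  proof (rule multilinearI)
    fix p q :: "'a list" assume len: "length p + length q + 1 = n"
    have Dg: "multilinear k (D \<circ> gamma)" for k
      using linear_comp[OF linear_D linear_gamma] by (auto intro: multilinearI)
    have "Vector_Spaces.linear scale scale
        (\<lambda>x. gamma (id_tensor_id i k 1 (D \<circ> gamma) (p @ x # q)))" if "n = i + j + k" for i j k
      using multilinearD[OF multilinear_id_tensor_id[OF multilinear_gamma Dg, of i k j], of p q] that len
      by (simp add: add_ac)
    then show "Vector_Spaces.linear scale scale (\<lambda>x. \<Sum>(i, k, j) | n = i + j + k \<and> 1 \<le> k.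
        (weight i * weight j) *s gamma (id_tensor_id i k 1 (D \<circ> gamma) (p @ x # q)))"
      by (intro linear_sum_fun) (auto intro!: linear_scale)
  qed
  then show ?thesis
    by (subst multilinear_cong) (use assms brace_eq_sum in auto)
qed

lemma has_degree_brace:
  assumes "1 \<le> n"
  shows "has_degree n 1 (brace D n)"
proof -
  have "has_degree k 1 (D \<circ> gamma)" if "1 \<le> k" for k
    using has_degree_gamma[OF that] D by (auto simp: has_degree_def differential_def)
  then have "has_degree n 1 (\<lambda>as. gamma (id_tensor_id i k 1 (D \<circ> gamma) as))"
    if "n = i + j + k" "1 \<le> k" for i j k
    using has_degree_id_tensor_id[OF has_degree_gamma, of i j k 1 "D \<circ> gamma" 1] that by (simp add: add_ac)
  then show ?thesis
    unfolding has_degree_def using assms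
    by (auto simp: brace_eq_sum intro!: subspace_sum[OF subspace_grade] subspace_scale[OF subspace_grade])
qed

lemma A_infinity_structure_brace: "A_infinity_structure D (brace D)"
  unfolding A_infinity_structure_def
proof (intro conjI allI impI)
  fix n :: nat and as :: "'a list" assume n: "1 \<le> n" "length as = n"
  have "(\<Sum>(i, k, j) | n = i + j + k \<and> k \<ge> 1.
      brace D (i + 1 + j) (id_tensor_id i k 1 (brace D k) as))
    = (\<Sum>(i, k, j) | length as = i + j + k \<and> 1 \<le> k.
      bracket (map \<sigma> (take i as) @ bracket (take k (drop i as)) # drop (i + k) as))"
    using n by (auto simp: bracket_def id_tensor_id_def intro!: sum.cong)
  also have "\<dots> = relator as"
    unfolding relator_def
    by (rule sum_arities_eq_sum_splits3[where F = "\<lambda>x y z. bracket (map \<sigma> x @ bracket y # z)"])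
  finally show "(\<Sum>(i, k, j) | n = i + j + k \<and> k \<ge> 1.
      brace D (i + 1 + j) (id_tensor_id i k 1 (brace D k) as)) = 0"
    by (simp add: relator_eq_0)
qed (use D in \<open>auto simp: brace_def multilinear_brace has_degree_brace\<close>)

end

end

theorem theorem1:
  fixes scale :: "'k::field_char_0 \<Rightarrow> 'a::ring \<Rightarrow> 'a"
    and A :: "int \<Rightarrow> 'a set"
    and \<Delta> :: "'a \<Rightarrow> 'a"
  assumes "graded_algebra scale A"
    and "graded_vector_space.differential scale A \<Delta>"
  shows "graded_vector_space.A_infinity_structure scale A \<Delta> (graded_algebra.brace scale A \<Delta>)"
  using graded_algebra.A_infinity_structure_brace[OF assms] .

end
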